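(* Let $T$ be a symmetric tree and let $g:A\to B$ be a function such that the functigraph $F_T$ is symmetric. Then $fix(F_T)=2|V(T)|-t$ for some $t\in\{2,3\}$ if and only if $T=P_2$.
   Context: A set $S\subseteq V(H)$ is a fixing set of a graph $H$ if the only automorphism of $H$ fixing every vertex of $S$ is the identity; $fix(H)$ is the minimum cardinality of a fixing set of $H$. A connected graph is symmetric if its fixing number is nonzero. Functigraph: let $G_1,G_2$ be disjoint copies of a connected graph $G$, with $A=V(G_1)$, $B=V(G_2)$, and let $g:A\to B$ be a function. The functigraph $F_G$ has vertex set $A\cup B$ and edge set $E(G_1)\cup E(G_2)\cup\{ug(u):u\in A\}$. *)

theory Defs
  imports Main
begin

definition simple_graph :: "'a set \<Rightarrow> ('a \<Rightarrow> 'a \<Rightarrow> bool) \<Rightarrow> bool" where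
  "simple_graph V E \<longleftrightarrow> finite V \<and>
     (\<forall>u v. E u v \<longrightarrow> u \<in> V \<and> v \<in> V) \<and>
     (\<forall>u v. E u v \<longrightarrow> E v u) \<and> (\<forall>u. \<not> E u u)"

definition connected_graph :: "'a set \<Rightarrow> ('a \<Rightarrow> 'a \<Rightarrow> bool) \<Rightarrow> bool" where
  "connected_graph V E \<longleftrightarrow> simple_graph V E \<and> V \<noteq> {} \<and>
     (\<forall>u\<in>V. \<forall>v\<in>V. E\<^sup>*\<^sup>* u v)"

definition is_cycle :: "('a \<Rightarrow> 'a \<Rightarrow> bool) \<Rightarrow> 'a list \<Rightarrow> bool" where
  "is_cycle E cs \<longleftrightarrow> length cs \<ge> 3 \<and> distinct cs \<and>
     (\<forall>i < length cs - 1. E (cs ! i) (cs ! Suc i)) \<and> E (last cs) (hd cs)"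

definition is_tree :: "'a set \<Rightarrow> ('a \<Rightarrow> 'a \<Rightarrow> bool) \<Rightarrow> bool" where
  "is_tree V E \<longleftrightarrow> connected_graph V E \<and> (\<nexists>cs. is_cycle E cs)"

definition automorphism :: "'a set \<Rightarrow> ('a \<Rightarrow> 'a \<Rightarrow> bool) \<Rightarrow> ('a \<Rightarrow> 'a) \<Rightarrow> bool" where
  "automorphism V E \<sigma> \<longleftrightarrow> bij_betw \<sigma> V V \<and>
     (\<forall>u\<in>V. \<forall>v\<in>V. E u v \<longleftrightarrow> E (\<sigma> u) (\<sigma> v))"

definition fixing_set :: "'a set \<Rightarrow> ('a \<Rightarrow> 'a \<Rightarrow> bool) \<Rightarrow> 'a set \<Rightarrow> bool" where
  "fixing_set V E S \<longleftrightarrow> S \<subseteq> V \<and>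
     (\<forall>\<sigma>. automorphism V E \<sigma> \<and> (\<forall>x\<in>S. \<sigma> x = x) \<longrightarrow> (\<forall>x\<in>V. \<sigma> x = x))"

definition fix_num :: "'a set \<Rightarrow> ('a \<Rightarrow> 'a \<Rightarrow> bool) \<Rightarrow> nat" where
  "fix_num V E = (LEAST k. \<exists>S. fixing_set V E S \<and> card S = k)"

definition symmetric_graph :: "'a set \<Rightarrow> ('a \<Rightarrow> 'a \<Rightarrow> bool) \<Rightarrow> bool" where
  "symmetric_graph V E \<longleftrightarrow> connected_graph V E \<and> fix_num V E \<noteq> 0"

text \<open>Functigraph: G_1 = Inl-copy (A), G_2 = Inr-copy (B); the function g : A \<rightarrow> B is
  given by f : V \<rightarrow> V via g (Inl u) = Inr (f u).\<close>
definition functi_V :: "'a set \<Rightarrow> ('a + 'a) set" where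
  "functi_V V = Inl ` V \<union> Inr ` V"

fun functi_E :: "'a set \<Rightarrow> ('a \<Rightarrow> 'a \<Rightarrow> bool) \<Rightarrow> ('a \<Rightarrow> 'a) \<Rightarrow> 'a + 'a \<Rightarrow> 'a + 'a \<Rightarrow> bool" where
  "functi_E V E f (Inl x) (Inl y) = E x y"
| "functi_E V E f (Inr x) (Inr y) = E x y"
| "functi_E V E f (Inl x) (Inr y) = (x \<in> V \<and> y = f x)"
| "functi_E V E f (Inr y) (Inl x) = (x \<in> V \<and> y = f x)"

definition is_P2 :: "'a set \<Rightarrow> ('a \<Rightarrow> 'a \<Rightarrow> bool) \<Rightarrow> bool" where
  "is_P2 V E \<longleftrightarrow> (\<exists>u v. u \<noteq> v \<and> V = {u, v} \<and> E u v)"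

end

theory Submission
  imports Defs
begin

text \<open>
  If \<open>T\<close> has at least three vertices, then four vertices of \<open>F\<^sub>T\<close> can always be left out of a fixing
  set, so that \<open>fix(F\<^sub>T) \<le> 2|V(T)| - 4\<close>. Two vertices of \<open>A\<close> with different images are told apart
  by \<open>B\<close>, and a vertex of degree at least two in \<open>B\<close> is told apart from every vertex of \<open>A\<close>,
  which has only one neighbour in \<open>B\<close>. This supplies the four vertices unless every two vertices
  with the same image are twins or \<open>g\<close> is constant. Since a tree has no triangle and no 4-cycle,
  twins force \<open>T\<close> to be a star whose leaves have one common image.
\<close>

section \<open>Bounding the fixing number by omitted vertices\<close>

text \<open>The complement of \<open>D\<close> is a fixing set once adjacency forces every
  automorphism that is the identity off \<open>D\<close> to be the identity on \<open>D\<close>.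
  Such an automorphism permutes \<open>D\<close>, so \<open>fixD\<close> may assume this and the
  image of an omitted vertex need only be sought among the few elements of \<open>D\<close>.\<close>

lemma fix_num_le_card_diff:
  assumes fin: "finite V" and D: "D \<subseteq> V"
    and fixD: "\<And>\<sigma> x. \<lbrakk>\<And>x. x \<in> V - D \<Longrightarrow> \<sigma> x = x; \<And>x. x \<in> D \<Longrightarrow> \<sigma> x \<in> D; inj_on \<sigma> D;
      \<And>x y. \<lbrakk>x \<in> V; y \<in> V\<rbrakk> \<Longrightarrow> E (\<sigma> x) (\<sigma> y) \<longleftrightarrow> E x y; x \<in> D\<rbrakk> \<Longrightarrow> \<sigma> x = x"
  shows "fix_num V E \<le> card V - card D"
proof -
  have "\<sigma> x = x"
    if aut: "automorphism V E \<sigma>" and off: "\<forall>x\<in>V - D. \<sigma> x = x" and x: "x \<in> V" for \<sigma> x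
  proof (cases "x \<in> D")
    case True
    have inj: "inj_on \<sigma> V" and img: "\<sigma> ` V = V"
      using aut by (auto simp: automorphism_def bij_betw_def)
    have "\<sigma> y \<in> D" if "y \<in> D" for y
    \<comment> \<open>If \<open>\<sigma> y\<close> lay off \<open>D\<close>, it would be a fixed
      point, so \<open>y\<close> and \<open>\<sigma> y\<close> would have the same image.\<close>
    proof (rule ccontr)
      assume "\<sigma> y \<notin> D"
      moreover have "\<sigma> y \<in> V" using that D img by blast
      ultimately have "\<sigma> (\<sigma> y) = \<sigma> y" using off by blast
      then have "\<sigma> y = y" using inj \<open>\<sigma> y \<in> V\<close> that D by (auto dest: inj_onD)
      then show False using \<open>\<sigma> y \<notin> D\<close> that by simp
    qed
    moreover have "inj_on \<sigma> D" using inj D by (rule inj_on_subset)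
    moreover have "E (\<sigma> y) (\<sigma> z) \<longleftrightarrow> E y z" if "y \<in> V" "z \<in> V" for y z
      using aut that by (auto simp: automorphism_def)
    ultimately show ?thesis using off True fixD[of \<sigma> x] by blast
  qed (use off x in blast)
  then have "fixing_set V E (V - D)"
    by (auto simp: fixing_set_def)
  then have "fix_num V E \<le> card (V - D)"
    unfolding fix_num_def by (intro Least_le) blast
  then show ?thesis
    using fin D by (simp add: card_Diff_subset finite_subset)
qed

lemma card_functi_V: "finite V \<Longrightarrow> card (functi_V V) = 2 * card V"
  unfolding functi_V_def by (subst card_Un_disjoint) (auto simp: card_image)

lemma fix_num_functi_le:
  assumes "finite V" and "D \<subseteq> functi_V V"
    and "\<And>\<sigma> x. \<lbrakk>\<And>x. x \<in> functi_V V - D \<Longrightarrow> \<sigma> x = x; \<And>x. x \<in> D \<Longrightarrow> \<sigma> x \<in> D; inj_on \<sigma> D;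
      \<And>x y. \<lbrakk>x \<in> functi_V V; y \<in> functi_V V\<rbrakk> \<Longrightarrow> functi_E V E f (\<sigma> x) (\<sigma> y) \<longleftrightarrow> functi_E V E f x y;
      x \<in> D\<rbrakk> \<Longrightarrow> \<sigma> x = x"
  shows "fix_num (functi_V V) (functi_E V E f) \<le> 2 * card V - card D"
proof -
  have "finite (functi_V V)" using assms(1) by (simp add: functi_V_def)
  then have "fix_num (functi_V V) (functi_E V E f) \<le> card (functi_V V) - card D"
    by (rule fix_num_le_card_diff) (fact assms(2,3))+
  then show ?thesis using assms(1) by (simp add: card_functi_V)
qed

section \<open>Four omissible vertices, in three configurations\<close>

text \<open>Having two neighbours in \<open>B\<close> pins down \<open>Inr c\<close>; then
  \<open>B\<close> is fixed pointwise and the fibres of \<open>f\<close> are preserved. The fibre of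
  \<open>a2\<close> avoids \<open>a1\<close> and \<open>a3\<close>, and \<open>sep\<close> prevents
  \<open>a1\<close> and \<open>a3\<close> from being exchanged, by their images or by a vertex
  \<open>b\<close> that sees only one of them.\<close>

lemma fix_num_functi_inhomogeneous:
  assumes G: "simple_graph V E" and fV: "f ` V \<subseteq> V"
    and V: "a1 \<in> V" "a2 \<in> V" "a3 \<in> V"
    and ne: "a1 \<noteq> a3" "f a1 \<noteq> f a2" "f a3 \<noteq> f a2"
    and sep: "f a1 \<noteq> f a3 \<or> b \<in> V - {a1, a3} \<and> E b a1 \<noteq> E b a3"
    and c: "E c x" "E c y" "x \<noteq> y"
  shows "fix_num (functi_V V) (functi_E V E f) \<le> 2 * card V - 4"
proof -
  let ?D = "{Inl a1, Inl a2, Inl a3, Inr c}"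
  have cV: "c \<in> V" "x \<in> V" "y \<in> V" and cx: "x \<noteq> c" "y \<noteq> c" and fin: "finite V"
    using G c unfolding simple_graph_def by metis+
  have "a1 \<noteq> a2" "a3 \<noteq> a2" using ne by auto
  then have card: "card ?D = 4" using ne(1) by auto
  have "fix_num (functi_V V) (functi_E V E f) \<le> 2 * card V - card ?D"
  proof (rule fix_num_functi_le)
    fix \<sigma> z
    assume off: "\<And>x. x \<in> functi_V V - ?D \<Longrightarrow> \<sigma> x = x"
      and on: "\<And>x. x \<in> ?D \<Longrightarrow> \<sigma> x \<in> ?D" and inj: "inj_on \<sigma> ?D"
      and hom: "\<And>x y. \<lbrakk>x \<in> functi_V V; y \<in> functi_V V\<rbrakk> \<Longrightarrow>
        functi_E V E f (\<sigma> x) (\<sigma> y) \<longleftrightarrow> functi_E V E f x y"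
      and z: "z \<in> ?D"
    have neq: "\<sigma> u \<noteq> \<sigma> v" if "u \<in> ?D" "v \<in> ?D" "u \<noteq> v" for u v
      using inj that by (meson inj_onD)
    have "\<sigma> (Inr x) = Inr x" "\<sigma> (Inr y) = Inr y"
      using off cV cx by (auto simp: functi_V_def)
    then have "functi_E V E f (\<sigma> (Inr c)) (Inr x)" "functi_E V E f (\<sigma> (Inr c)) (Inr y)"
      using hom[of "Inr c" "Inr x"] hom[of "Inr c" "Inr y"] c cV by (auto simp: functi_V_def)
    \<comment> \<open>The other omitted vertices lie in \<open>A\<close> and have a single neighbour
      in \<open>B\<close>, so none is adjacent to both \<open>Inr x\<close> and
      \<open>Inr y\<close>.\<close>
    then have c_fix: "\<sigma> (Inr c) = Inr c"
      using on[of "Inr c"] c(3) by auto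
    have B_fix: "\<sigma> (Inr v) = Inr v" if "v \<in> V" for v
      using c_fix off that by (cases "v = c") (auto simp: functi_V_def)
    have A_fib: "\<exists>a' \<in> {a1, a2, a3}. \<sigma> (Inl a) = Inl a' \<and> f a' = f a" if a: "a \<in> {a1, a2, a3}" for a
    proof -
      have aV: "a \<in> V" using a V by auto
      have "\<sigma> (Inl a) \<noteq> \<sigma> (Inr c)"
        using a by (intro neq) auto
      then obtain a' where a': "a' \<in> {a1, a2, a3}" "\<sigma> (Inl a) = Inl a'"
        using on[of "Inl a"] a c_fix by auto
      have "f a \<in> V" using aV fV by auto
      then have "f a' = f a"
        using hom[of "Inl a" "Inr (f a)"] B_fix a' aV by (auto simp: functi_V_def)
      then show ?thesis using a' by blast
    qed
    have a2_fix: "\<sigma> (Inl a2) = Inl a2"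
      using A_fib[of a2] ne by auto
    have "\<sigma> (Inl a1) = Inl a1"
    proof (rule ccontr)
      assume "\<sigma> (Inl a1) \<noteq> Inl a1"
      then have s: "\<sigma> (Inl a1) = Inl a3" "f a1 = f a3" using A_fib[of a1] ne by auto
      then have b: "b \<in> V - {a1, a3}" "E b a1 \<noteq> E b a3" using sep by auto
      \<comment> \<open>Here \<open>b\<close> may be \<open>a2\<close>, which is omitted but already
        known to be fixed.\<close>
      have "\<sigma> (Inl b) = Inl b"
        using a2_fix off b by (cases "b = a2") (auto simp: functi_V_def)
      then show False using hom[of "Inl b" "Inl a1"] s b V by (auto simp: functi_V_def)
    qed
    moreover from this have "\<sigma> (Inl a3) = Inl a3"
      using A_fib[of a3] neq[of "Inl a1" "Inl a3"] ne by auto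
    ultimately show "\<sigma> z = z" using z a2_fix c_fix by auto
  qed (use fin V cV in \<open>auto simp: functi_V_def\<close>)
  then show ?thesis by (simp add: card)
qed

text \<open>For constant \<open>f\<close>, \<open>Inr w\<close> is adjacent to all of
  \<open>A\<close> and is the only link from \<open>B\<close> to \<open>A\<close>. The vertices
  \<open>Inl y\<close> and \<open>Inr s\<close> stay fixed and serve as witnesses: adjacency to them
  singles out \<open>Inr w\<close> and \<open>Inl c\<close>, after which \<open>Inl c\<close>
  separates \<open>Inl x\<close> from \<open>Inr r\<close>.\<close>

lemma fix_num_functi_const:
  assumes G: "simple_graph V E"
    and const: "\<And>v. v \<in> V \<Longrightarrow> f v = w" and w: "E w s" "r \<in> V" "r \<noteq> w" "r \<noteq> s"
    and c: "E c x" "E c y" "\<not> E x y" "x \<noteq> y"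
  shows "fix_num (functi_V V) (functi_E V E f) \<le> 2 * card V - 4"
proof -
  let ?D = "{Inl c, Inl x, Inr w, Inr r}"
  have V: "c \<in> V" "x \<in> V" "y \<in> V" "w \<in> V" "s \<in> V" and ne: "x \<noteq> c" "y \<noteq> c" "s \<noteq> w"
    and fin: "finite V" and sym: "\<And>u v. E u v \<longleftrightarrow> E v u"
    using G c w(1) unfolding simple_graph_def by metis+
  have card: "card ?D = 4" using ne w by auto
  have "fix_num (functi_V V) (functi_E V E f) \<le> 2 * card V - card ?D"
  proof (rule fix_num_functi_le)
    fix \<sigma> z
    assume off: "\<And>x. x \<in> functi_V V - ?D \<Longrightarrow> \<sigma> x = x"
      and on: "\<And>x. x \<in> ?D \<Longrightarrow> \<sigma> x \<in> ?D" and inj: "inj_on \<sigma> ?D"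
      and hom: "\<And>x y. \<lbrakk>x \<in> functi_V V; y \<in> functi_V V\<rbrakk> \<Longrightarrow>
        functi_E V E f (\<sigma> x) (\<sigma> y) \<longleftrightarrow> functi_E V E f x y"
      and z: "z \<in> ?D"
    have neq: "\<sigma> u \<noteq> \<sigma> v" if "u \<in> ?D" "v \<in> ?D" "u \<noteq> v" for u v
      using inj that by (meson inj_onD)
    have D: "?D \<subseteq> functi_V V" using V w by (auto simp: functi_V_def)
    have "\<sigma> (Inl y) = Inl y" "\<sigma> (Inr s) = Inr s"
      using off V ne c w by (auto simp: functi_V_def)
    then have y: "functi_E V E f (\<sigma> u) (Inl y) \<longleftrightarrow> functi_E V E f u (Inl y)"
      and s: "functi_E V E f (\<sigma> u) (Inr s) \<longleftrightarrow> functi_E V E f u (Inr s)"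
      if "u \<in> ?D" for u
      using that D V hom[of u "Inl y"] hom[of u "Inr s"] by (auto simp: functi_V_def)
    \<comment> \<open>Adjacency to \<open>Inl y\<close> and \<open>Inr s\<close>: both for
      \<open>Inr w\<close>, only the first for \<open>Inl c\<close>, while \<open>Inl x\<close> and
      \<open>Inr r\<close> miss the first.\<close>
    have E_y: "functi_E V E f (Inl c) (Inl y)" "\<not> functi_E V E f (Inl x) (Inl y)"
      "functi_E V E f (Inr w) (Inl y)" "\<not> functi_E V E f (Inr r) (Inl y)"
      and E_s: "\<not> functi_E V E f (Inl c) (Inr s)" "functi_E V E f (Inr w) (Inr s)"
      and E_c: "functi_E V E f (Inl x) (Inl c)" "\<not> functi_E V E f (Inr r) (Inl c)"
      using c w V const ne(3) sym by auto
    have w_fix: "\<sigma> (Inr w) = Inr w"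
      using y[of "Inr w"] s[of "Inr w"] on[of "Inr w"] E_y E_s by auto
    have c_fix: "\<sigma> (Inl c) = Inl c"
      using y[of "Inl c"] s[of "Inl c"] on[of "Inl c"] E_y E_s by auto
    have x_fix: "\<sigma> (Inl x) = Inl x"
      using hom[of "Inl x" "Inl c"] D y[of "Inl x"] on[of "Inl x"] E_y E_c c_fix by auto
    \<comment> \<open>The last omitted vertex is fixed by injectivity alone.\<close>
    have "\<sigma> (Inr r) = Inr r"
      using on[of "Inr r"] w_fix c_fix x_fix w neq[of "Inr r" "Inl c"] neq[of "Inr r" "Inl x"]
        neq[of "Inr r" "Inr w"] by auto
    then show "\<sigma> z = z" using z w_fix c_fix x_fix by auto
  qed (use fin V w in \<open>auto simp: functi_V_def\<close>)
  then show ?thesis by (simp add: card)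
qed

text \<open>This is the star with centre \<open>c\<close> whose leaves share the image
  \<open>w\<close>, the configuration that neither preceding bound reaches. Both centres and one
  leaf of each copy are omitted; \<open>Inl y\<close> remains as a fixed witness. The argument
  depends on whether \<open>Inr w\<close> is the centre of \<open>B\<close> or a leaf.\<close>

lemma fix_num_functi_star:
  assumes G: "simple_graph V E" and fV: "f ` V \<subseteq> V"
    and cV: "c \<in> V" and star: "\<And>v. v \<in> V - {c} \<Longrightarrow> E c v"
    and leaves: "\<And>u v. \<lbrakk>u \<in> V - {c}; v \<in> V - {c}\<rbrakk> \<Longrightarrow> \<not> E u v"
    and f: "\<And>v. v \<in> V - {c} \<Longrightarrow> f v = w" "f c \<noteq> w"
    and xy: "x \<in> V - {c}" "y \<in> V - {c}" "x \<noteq> y"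
  shows "fix_num (functi_V V) (functi_E V E f) \<le> 2 * card V - 4"
proof -
  have fin: "finite V" and sym: "\<And>u v. E u v \<longleftrightarrow> E v u" and irr: "\<And>u. \<not> E u u"
    using G unfolding simple_graph_def by metis+
  have wV: "w \<in> V" using f(1)[OF xy(1)] fV xy(1) by auto
  \<comment> \<open>The leaf \<open>r\<close> must avoid \<open>f c\<close> when
    \<open>w = c\<close>, and \<open>w\<close> otherwise. In each case a single vertex is forbidden,
    so one of the two leaves \<open>x\<close>, \<open>y\<close> will do.\<close>
  define r where "r = (if w = c then if x = f c then y else x else if x = w then y else x)"
  have r: "r \<in> V - {c}" "r \<noteq> w" "w = c \<Longrightarrow> r \<noteq> f c"
    using xy by (auto simp: r_def)
  let ?D = "{Inl c, Inl x, Inr c, Inr r}"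
  have card: "card ?D = 4" using xy r by auto
  have "fix_num (functi_V V) (functi_E V E f) \<le> 2 * card V - card ?D"
  proof (rule fix_num_functi_le)
    fix \<sigma> z
    assume off: "\<And>x. x \<in> functi_V V - ?D \<Longrightarrow> \<sigma> x = x"
      and on: "\<And>x. x \<in> ?D \<Longrightarrow> \<sigma> x \<in> ?D" and inj: "inj_on \<sigma> ?D"
      and hom: "\<And>x y. \<lbrakk>x \<in> functi_V V; y \<in> functi_V V\<rbrakk> \<Longrightarrow>
        functi_E V E f (\<sigma> x) (\<sigma> y) \<longleftrightarrow> functi_E V E f x y"
      and z: "z \<in> ?D"
    have neq: "\<sigma> u \<noteq> \<sigma> v" if "u \<in> ?D" "v \<in> ?D" "u \<noteq> v" for u v
      using inj that by (meson inj_onD)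
    have D: "?D \<subseteq> functi_V V" using cV xy r by (auto simp: functi_V_def)
    have E_cc: "functi_E V E f (Inl c) (Inl x)" "functi_E V E f (Inr r) (Inr c)"
      "\<not> functi_E V E f (Inl c) (Inl c)" "\<not> functi_E V E f (Inr c) (Inr c)"
      "\<not> functi_E V E f (Inl x) (Inr r)" "\<not> functi_E V E f (Inr r) (Inl x)"
      using star[OF xy(1)] star[OF r(1)] sym[of r c] irr f(1)[OF xy(1)] r(2) by auto
    have y_fix: "\<sigma> (Inl y) = Inl y"
      using off xy by (auto simp: functi_V_def)
    have y: "functi_E V E f (\<sigma> u) (Inl y) \<longleftrightarrow> functi_E V E f u (Inl y)" if "u \<in> ?D" for u
      using that D hom[of u "Inl y"] y_fix xy by (auto simp: functi_V_def)
    have E_y: "functi_E V E f (Inl c) (Inl y)" "\<not> functi_E V E f (Inl x) (Inl y)"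
      "\<not> functi_E V E f (Inr r) (Inl y)" "functi_E V E f (Inr c) (Inl y) \<longleftrightarrow> w = c"
      using star[OF xy(2)] leaves[OF xy(1,2)] f(1)[OF xy(2)] r(2) xy by auto
    show "\<sigma> z = z"
    proof (cases "w = c")
      case True
      have E_w: "functi_E V E f (Inl x) (Inl c)" "functi_E V E f (Inl x) (Inr c)"
        "\<not> functi_E V E f (Inr r) (Inl c)"
        using star[OF xy(1)] sym[of x c] f(1)[OF xy(1)] r True xy by auto
      \<comment> \<open>Both centres are adjacent to \<open>Inl y\<close> and both omitted leaves
        are not, so each pair is preserved.\<close>
      have cs: "\<sigma> (Inl c) \<in> {Inl c, Inr c}" "\<sigma> (Inr c) \<in> {Inl c, Inr c}"
        using y[of "Inl c"] y[of "Inr c"] on[of "Inl c"] on[of "Inr c"] E_y True by auto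
      have ls: "\<sigma> (Inl x) \<in> {Inl x, Inr r}" "\<sigma> (Inr r) \<in> {Inl x, Inr r}"
        using y[of "Inl x"] y[of "Inr r"] on[of "Inl x"] on[of "Inr r"] E_y True by auto
      \<comment> \<open>Whichever centre is sent to \<open>Inl c\<close>, it is adjacent to
        \<open>Inl x\<close>; hence the image of \<open>Inl x\<close> is adjacent to
        \<open>Inl c\<close>, which \<open>Inr r\<close> is not because
        \<open>r \<noteq> f c\<close>.\<close>
      have "\<sigma> (Inl c) = Inl c \<or> \<sigma> (Inr c) = Inl c"
        using cs neq[of "Inl c" "Inr c"] by auto
      moreover have "functi_E V E f (\<sigma> (Inl x)) (\<sigma> (Inl c))" "functi_E V E f (\<sigma> (Inl x)) (\<sigma> (Inr c))"
        using hom E_w D by auto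
      ultimately have x_fix: "\<sigma> (Inl x) = Inl x" using ls E_w by auto
      then have r_fix: "\<sigma> (Inr r) = Inr r" using ls neq[of "Inl x" "Inr r"] by auto
      then have "\<sigma> (Inr c) = Inr c"
        using cs hom[of "Inr r" "Inr c"] D E_cc E_w by auto
      then show ?thesis using x_fix r_fix cs z neq[of "Inl c" "Inr c"] by auto
    next
      case False
      \<comment> \<open>Now \<open>w\<close> is a leaf other than \<open>r\<close>, so
        \<open>Inr w\<close> is a second fixed witness; of the omitted vertices it sees exactly
        \<open>Inl x\<close> and \<open>Inr c\<close>.\<close>
      have w_fix: "\<sigma> (Inr w) = Inr w"
        using off False r(2) wV by (auto simp: functi_V_def)
      have w: "functi_E V E f (\<sigma> u) (Inr w) \<longleftrightarrow> functi_E V E f u (Inr w)" if "u \<in> ?D" for u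
        using that D hom[of u "Inr w"] w_fix wV by (auto simp: functi_V_def)
      have E_w: "functi_E V E f (Inl x) (Inr w)" "functi_E V E f (Inr c) (Inr w)"
        "\<not> functi_E V E f (Inl c) (Inr w)" "\<not> functi_E V E f (Inr r) (Inr w)"
        using star[of w] leaves[OF r(1), of w] f(1)[OF xy(1)] f(2) wV xy False by auto
      have c_fix: "\<sigma> (Inl c) = Inl c"
        using y[of "Inl c"] on[of "Inl c"] E_y False by auto
      have r_fix: "\<sigma> (Inr r) = Inr r"
        using w[of "Inr r"] on[of "Inr r"] E_w c_fix neq[of "Inl c" "Inr r"] by auto
      have "\<sigma> (Inr c) = Inr c"
        using hom[of "Inr r" "Inr c"] D r_fix on[of "Inr c"] E_cc c_fix w[of "Inr c"] E_w
        neq[of "Inl c" "Inr c"] by auto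
      moreover from this have "\<sigma> (Inl x) = Inl x"
        using on[of "Inl x"] c_fix r_fix xy neq[of "Inl x" "Inl c"] neq[of "Inl x" "Inr c"]
          neq[of "Inl x" "Inr r"] by auto
      ultimately show ?thesis using c_fix r_fix z by auto
    qed
  qed (use fin cV xy r in \<open>auto simp: functi_V_def\<close>)
  then show ?thesis by (simp add: card)
qed

section \<open>Connected graphs and short cycles in trees\<close>

text \<open>If every vertex had at most one neighbour, a walk from \<open>u\<close> could only go
  back and forth along one edge, leaving at most two vertices.\<close>

lemma connected_graph_two_neighbours:
  assumes G: "connected_graph V E" and n: "card V \<ge> 3"
  obtains c x y where "E c x" "E c y" "x \<noteq> y"
proof -
  have sym: "\<And>u v. E u v \<Longrightarrow> E v u" and conn: "\<And>u v. \<lbrakk>u \<in> V; v \<in> V\<rbrakk> \<Longrightarrow> E\<^sup>*\<^sup>* u v"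
    using G unfolding connected_graph_def simple_graph_def by blast+
  obtain W where "W \<subseteq> V" "card W = 3" using n by (rule obtain_subset_with_card_n)
  then obtain u v where uv: "u \<in> V" "v \<in> V" "u \<noteq> v" by (auto simp: card_3_iff)
  have "E\<^sup>*\<^sup>* u v" using conn uv by blast
  then obtain x where x: "E u x" using uv by (meson converse_rtranclpE)
  show thesis
  proof (rule ccontr)
    assume no: "\<not> thesis"
    have un: "\<And>c x y. E c x \<Longrightarrow> E c y \<Longrightarrow> x = y" using that no by blast
    have "z \<in> {u, x}" if "E\<^sup>*\<^sup>* u z" for z
      using that
    proof induction
      case (step y z)
      then show ?case using un[OF step(2)] x sym by blast
    qed simp
    then have "V \<subseteq> {u, x}" using conn uv by blast
    then have "card V \<le> card {u, x}" by (intro card_mono) auto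
    also have "\<dots> \<le> 2" by (simp add: card_insert_if)
    finally show False using n by simp
  qed
qed

lemma connected_graph_neighbour:
  assumes "connected_graph V E" and "u \<in> V" "v \<in> V" "u \<noteq> v"
  obtains x where "E u x"
proof -
  have "E\<^sup>*\<^sup>* u v" using assms unfolding connected_graph_def by blast
  then show thesis using that assms(4) by (meson converse_rtranclpE)
qed

lemma is_tree_no_triangle: "\<lbrakk>is_tree V E; E a b; E b c; E c a\<rbrakk> \<Longrightarrow> False"
proof -
  assume T: "is_tree V E" and e: "E a b" "E b c" "E c a"
  then have "is_cycle E [a, b, c]"
    by (auto simp: is_cycle_def less_Suc_eq is_tree_def connected_graph_def simple_graph_def)
  then show False using T by (auto simp: is_tree_def)
qed

lemma is_tree_no_square:
  "\<lbrakk>is_tree V E; E a b; E b c; E c d; E d a; a \<noteq> c; b \<noteq> d\<rbrakk> \<Longrightarrow> False"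
proof -
  assume T: "is_tree V E" and e: "E a b" "E b c" "E c d" "E d a" "a \<noteq> c" "b \<noteq> d"
  then have "is_cycle E [a, b, c, d]"
    by (auto simp: is_cycle_def less_Suc_eq is_tree_def connected_graph_def simple_graph_def)
  then show False using T by (auto simp: is_tree_def)
qed

section \<open>The bound for trees with at least three vertices\<close>

lemma fix_num_functi_tree_le:
  assumes T: "is_tree V E" and fV: "f ` V \<subseteq> V" and n: "card V \<ge> 3"
  shows "fix_num (functi_V V) (functi_E V E f) \<le> 2 * card V - 4"
proof (rule ccontr)
  assume large: "\<not> ?thesis"
  have conn: "connected_graph V E" using T by (simp add: is_tree_def)
  then have G: "simple_graph V E" by (simp add: connected_graph_def)
  then have fin: "finite V" and sym: "\<And>u v. E u v \<Longrightarrow> E v u" and irr: "\<And>u. \<not> E u u"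
    and EV: "\<And>u v. E u v \<Longrightarrow> u \<in> V \<and> v \<in> V"
    unfolding simple_graph_def by blast+
  obtain c x y where c: "E c x" "E c y" "x \<noteq> y"
    using connected_graph_two_neighbours[OF conn n] .
  have V: "c \<in> V" "x \<in> V" "y \<in> V" using EV c by auto
  have xy: "x \<noteq> c" "y \<noteq> c" using c irr by auto
  \<comment> \<open>Read as a refutation rule: under \<open>large\<close>, no triple
    \<open>a1\<close>, \<open>a2\<close>, \<open>a3\<close> with the required separation
    exists.\<close>
  note inh = fix_num_functi_inhomogeneous[OF G fV _ _ _ _ _ _ _ c, THEN notE[OF large]]
  have nonconst: "\<exists>a2\<in>V. f a2 \<noteq> f a" if "a \<in> V" for a
  proof (rule ccontr)
    assume "\<not> ?thesis"
    then have const: "\<And>v. v \<in> V \<Longrightarrow> f v = f a" by blast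
    have w: "f a \<in> V" using that fV by auto
    obtain v where "v \<in> V" "v \<noteq> f a" using V c by blast
    then obtain s where s: "E (f a) s" using connected_graph_neighbour[OF conn w] by metis
    \<comment> \<open>A third vertex \<open>r\<close> besides \<open>f a\<close> and its neighbour
      \<open>s\<close> is what the bound for constant \<open>f\<close> asks for.\<close>
    have "card {f a, s} < card V" using n by (simp add: card_insert_if)
    then have "\<not> V \<subseteq> {f a, s}" using card_mono[of "{f a, s}" V] by auto
    then obtain r where "r \<in> V" "r \<noteq> f a" "r \<noteq> s" by blast
    moreover have "\<not> E x y" using is_tree_no_triangle[OF T c(1), of y] c(2) sym by blast
    ultimately show False
      using large fix_num_functi_const[of V E f "f a" s r c x y, OF G const s] c by blast
  qed
  have twins: "E b a1 \<longleftrightarrow> E b a3" if a: "a1 \<in> V" "a3 \<in> V" "f a1 = f a3" "b \<in> V - {a1, a3}" for a1 a3 b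
  proof (rule ccontr)
    assume "E b a1 \<noteq> E b a3"
    \<comment> \<open>Non-constancy supplies the vertex \<open>a2\<close> outside the common fibre
      of \<open>a1\<close> and \<open>a3\<close>.\<close>
    moreover obtain a2 where "a2 \<in> V" "f a2 \<noteq> f a1" using nonconst a(1) by blast
    ultimately show False using inh[of a1 a2 a3 b] a by metis
  qed
  \<comment> \<open>Otherwise \<open>x\<close> and \<open>c\<close> would be twins, and the edge
    from \<open>y\<close> to \<open>c\<close> would give one from \<open>y\<close> to
    \<open>x\<close>, closing a triangle.\<close>
  have fx: "f x \<noteq> f c"
  proof
    assume "f x = f c"
    then have "E y x" using twins[of c x y] c sym V xy by auto
    then show False using is_tree_no_triangle[OF T c(1), of y] c(2) sym by blast
  qed
  have star: "f z = f x \<and> E c z" if z: "z \<in> V - {c}" for z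
  proof -
    \<comment> \<open>A twin \<open>z\<close> of \<open>c\<close> is not \<open>x\<close> by
      \<open>fx\<close>. If it were \<open>y\<close>, there would be a triangle; otherwise it is
      adjacent to \<open>x\<close> and \<open>y\<close> and closes the square \<open>c\<close>,
      \<open>x\<close>, \<open>z\<close>, \<open>y\<close>.\<close>
    have "f z \<noteq> f c"
    proof
      assume eq: "f z = f c"
      then have "z \<noteq> x" using fx by auto
      have "z \<noteq> y"
      proof
        assume "z = y"
        then have "E x y" using twins[of c y x] eq c sym V xy by auto
        then show False using is_tree_no_triangle[OF T c(1), of y] c(2) sym by blast
      qed
      have "E x z" "E y z"
        using twins[of c z x] twins[of c z y] eq c sym V xy z \<open>z \<noteq> x\<close> \<open>z \<noteq> y\<close> by auto
      then show False
        using is_tree_no_square[OF T c(1), of z y] sym c z by blast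
    qed
    have fz: "f z = f x"
    proof (rule ccontr)
      assume "f z \<noteq> f x"
      \<comment> \<open>The images of \<open>x\<close>, \<open>c\<close>, \<open>z\<close> would be
        pairwise different, so \<open>sep\<close> holds by its first alternative.\<close>
      then show False using inh[of x c z] V z fx \<open>f z \<noteq> f c\<close> by auto
    qed
    moreover have "E c z" using twins[of x z c] fz z V xy c by auto
    ultimately show ?thesis by blast
  qed
  have leaves: "\<not> E u v" if "u \<in> V - {c}" "v \<in> V - {c}" for u v
    using is_tree_no_triangle[OF T, of c u v] star that sym by blast
  have "fix_num (functi_V V) (functi_E V E f) \<le> 2 * card V - 4"
  proof (rule fix_num_functi_star[OF G fV V(1)])
    show "E c v" "f v = f x" if "v \<in> V - {c}" for v using star[OF that] by blast+
    show "f c \<noteq> f x" using fx by metis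
    show "x \<in> V - {c}" "y \<in> V - {c}" using V xy by auto
  qed (fact leaves c(3))+
  then show False using large by blast
qed

section \<open>The path on two vertices\<close>

text \<open>Two vertices can be omitted as soon as a third vertex \<open>s\<close> is adjacent to
  exactly one of them, since \<open>s\<close> is fixed and rules out their exchange.\<close>

lemma fix_num_functi_P2_le:
  assumes G: "simple_graph V E" and V: "V = {u, v}" "E u v" and fV: "f ` V \<subseteq> V"
  shows "fix_num (functi_V V) (functi_E V E f) \<le> 2"
proof -
  have fin: "finite V" and uv: "u \<noteq> v" and E: "E v u" "\<not> E u u" "\<not> E v v"
    using G V(2) unfolding simple_graph_def by metis+
  \<comment> \<open>If \<open>f\<close> is constant, \<open>s\<close> is the vertex of
    \<open>B\<close> outside the image: it sees \<open>d\<close> but not \<open>Inl v\<close>. If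
    not, \<open>s\<close> is the image of \<open>v\<close> and sees \<open>Inl v\<close> but not
    \<open>d = Inl u\<close>.\<close>
  define d where "d = (if f u = f v then Inr (f u) else Inl u)"
  define s :: "'a + 'a" where "s = (if f u = f v then Inr (if f u = u then v else u) else Inr (f v))"
  let ?D = "{Inl v, d}"
  have s: "s \<in> functi_V V - ?D" and d: "d \<in> functi_V V" "d \<noteq> Inl v"
    and sep: "functi_E V E f (Inl v) s \<noteq> functi_E V E f d s"
  proof -
    have mem: "u \<in> V" "v \<in> V" "f u \<in> {u, v}" "f v \<in> {u, v}"
      using V(1) fV by auto
    then have fm: "f u \<in> V" "f v \<in> V" using V(1) by auto
    show "s \<in> functi_V V - ?D" "d \<in> functi_V V" "d \<noteq> Inl v"
      using mem(1,2) fm uv by (auto simp: s_def d_def functi_V_def)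
    show "functi_E V E f (Inl v) s \<noteq> functi_E V E f d s"
      using mem uv E V(2) by (auto simp: s_def d_def)
  qed
  have "fix_num (functi_V V) (functi_E V E f) \<le> 2 * card V - card ?D"
  proof (rule fix_num_functi_le)
    fix \<sigma> z
    assume off: "\<And>x. x \<in> functi_V V - ?D \<Longrightarrow> \<sigma> x = x"
      and on: "\<And>x. x \<in> ?D \<Longrightarrow> \<sigma> x \<in> ?D"
      and hom: "\<And>x y. \<lbrakk>x \<in> functi_V V; y \<in> functi_V V\<rbrakk> \<Longrightarrow>
        functi_E V E f (\<sigma> x) (\<sigma> y) \<longleftrightarrow> functi_E V E f x y"
      and z: "z \<in> ?D"
    have "z \<in> functi_V V" using z d V by (auto simp: functi_V_def)
    then have "functi_E V E f (\<sigma> z) s \<longleftrightarrow> functi_E V E f z s"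
      using hom[of z s] off[OF s] s by simp
    then show "\<sigma> z = z" using on[OF z] z sep by auto
  qed (use fin d V in \<open>auto simp: functi_V_def\<close>)
  also have "\<dots> = 2" using V uv d by auto
  finally show ?thesis .
qed

section \<open>Comparing the bounds with \<open>2|V| - t\<close>\<close>

theorem theorem3p10:
  fixes V :: "'a set" and E :: "'a \<Rightarrow> 'a \<Rightarrow> bool" and f :: "'a \<Rightarrow> 'a"
  assumes "is_tree V E"
    and "symmetric_graph V E"
    and "f ` V \<subseteq> V"
    and "symmetric_graph (functi_V V) (functi_E V E f)"
  shows "(\<exists>t \<in> {2, 3 :: int}. int (fix_num (functi_V V) (functi_E V E f)) = 2 * int (card V) - t)
         \<longleftrightarrow> is_P2 V E"
proof
  have conn: "connected_graph V E" and G: "simple_graph V E"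
    using assms(1) by (auto simp: is_tree_def connected_graph_def)
  have pos: "fix_num (functi_V V) (functi_E V E f) > 0"
    using assms(4) by (simp add: symmetric_graph_def)
  {
    assume "\<exists>t \<in> {2, 3 :: int}. int (fix_num (functi_V V) (functi_E V E f)) = 2 * int (card V) - t"
    then have eq: "fix_num (functi_V V) (functi_E V E f) + 2 = 2 * card V \<or>
      fix_num (functi_V V) (functi_E V E f) + 3 = 2 * card V" by auto
    then have "card V < 3" using fix_num_functi_tree_le[OF assms(1,3)] by linarith
    \<comment> \<open>A single vertex would leave the value 0 for \<open>t = 2\<close> and a
      negative one for \<open>t = 3\<close>.\<close>
    moreover have "card V > 1" using eq pos by linarith
    ultimately have "card V = 2" by simp
    then obtain u v where uv: "V = {u, v}" "u \<noteq> v" by (auto simp: card_2_iff)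
    then obtain x where "E u x" using connected_graph_neighbour[OF conn, of u v] by blast
    moreover from this have "x = v" using G uv unfolding simple_graph_def by blast
    ultimately show "is_P2 V E" using uv by (auto simp: is_P2_def)
  next
    assume "is_P2 V E"
    then obtain u v where uv: "u \<noteq> v" "V = {u, v}" "E u v" by (auto simp: is_P2_def)
    then have "fix_num (functi_V V) (functi_E V E f) \<le> 2"
      using fix_num_functi_P2_le[OF G _ _ assms(3)] by blast
    \<comment> \<open>The fixing number is then 1 or 2, that is \<open>4 - t\<close> with
      \<open>t = 3\<close> or \<open>t = 2\<close>.\<close>
    moreover have "card V = 2" using uv by simp
    ultimately show "\<exists>t \<in> {2, 3 :: int}.
        int (fix_num (functi_V V) (functi_E V E f)) = 2 * int (card V) - t"
      using pos by auto
  }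
qed

end
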